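(* Fix $\lambda>0$ and a Borel set $S\subset\mathbb{R}^d$ with $\mathcal{L}(S)\in(0,\infty)$, where $\mathcal{L}$ is Lebesgue measure on $\mathbb{R}^d$. Let $\Pi$ be a homogeneous Poisson point process of intensity $\lambda$ on $S$. There does not exist a measurable function $f$ (from the set of simple point measures on $S$ to itself) such that $f(\Pi)$ is a homogeneous Poisson point process on $S$ of intensity strictly larger than $\lambda$.
   Context: Point processes on $S$ are viewed as random simple point measures on $S$ (finite $\{0,1,2,\dots\}$-valued measures with mass at most one at each point), with the $\sigma$-algebra generated by the maps $\nu\mapsto\nu(A)$, $A\subseteq S$ Borel. No relation between the points of $f(\Pi)$ and those of $\Pi$ is required. *)

theory Defs
  imports "HOL-Probability.Probability"
begin

definition simple_point_measures :: "'a::euclidean_space set \<Rightarrow> 'a measure set" where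
  "simple_point_measures S =
    {\<nu>. finite_measure \<nu> \<and> sets \<nu> = sets (restrict_space borel S) \<and>
         (\<forall>A\<in>sets \<nu>. emeasure \<nu> A \<in> \<nat>) \<and>
         (\<forall>x\<in>S. emeasure \<nu> {x} \<le> 1)}"

text \<open>The \<open>\<sigma>\<close>-algebra is the coarsest one making every map \<open>\<nu> \<mapsto> \<nu> A\<close> measurable,
  for \<open>A\<close> a Borel subset of \<open>S\<close>.\<close>

definition point_measure_space :: "'a::euclidean_space set \<Rightarrow> 'a measure measure" where
  "point_measure_space S =
    sigma (simple_point_measures S)
      {{\<nu> \<in> simple_point_measures S. emeasure \<nu> A \<in> B} | A B.
         A \<in> sets (restrict_space borel S) \<and> B \<in> sets (borel :: ennreal measure)}"

text \<open>
  A homogeneous Poisson point process of intensity \<open>\<mu>\<close> on a Borel set \<open>S\<close> of finite Lebesgue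
  measure (the realisations are finite measures, so \<open>S\<close> of infinite measure is not meant).
  The Poisson weights are written out because \<^const>\<open>poisson_pmf\<close> is only specified for strictly
  positive rates, whereas Lebesgue-null sets \<open>A\<close> have rate \<open>0\<close>; there \<open>0 ^ 0 = 1\<close> gives the point
  mass at \<open>0\<close>.
\<close>

definition (in prob_space) poisson_process ::
    "'b::euclidean_space set \<Rightarrow> real \<Rightarrow> ('a \<Rightarrow> 'b measure) \<Rightarrow> bool" where
  "poisson_process S \<mu> N \<longleftrightarrow>
    N \<in> measurable M (point_measure_space S) \<and>
    (\<forall>A\<in>sets (restrict_space borel S). \<forall>k::nat.
       prob {\<omega> \<in> space M. emeasure (N \<omega>) A = of_nat k} =
         (\<mu> * measure lborel A) ^ k / fact k * exp (- (\<mu> * measure lborel A))) \<and>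
    (\<forall>n. \<forall>A :: nat \<Rightarrow> 'b set.
       (\<forall>i<n. A i \<in> sets (restrict_space borel S)) \<longrightarrow> disjoint_family_on A {..<n} \<longrightarrow>
       indep_vars (\<lambda>_. borel) (\<lambda>i \<omega>. emeasure (N \<omega>) (A i)) {..<n})"

lemma space_point_measure_space: "space (point_measure_space S) = simple_point_measures S"
  unfolding point_measure_space_def by (rule space_measure_of) auto

lemma measurable_emeasure_point_measure_space:
  assumes "A \<in> sets (restrict_space borel S)"
  shows "(\<lambda>\<nu>. emeasure \<nu> A) \<in> borel_measurable (point_measure_space S)"
proof (rule measurableI)
  fix B :: "ennreal set" assume "B \<in> sets borel"
  then have "{\<nu> \<in> simple_point_measures S. emeasure \<nu> A \<in> B} \<in> sets (point_measure_space S)"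
    unfolding point_measure_space_def using assms by (intro in_measure_of) auto
  then show "(\<lambda>\<nu>. emeasure \<nu> A) -` B \<inter> space (point_measure_space S) \<in> sets (point_measure_space S)"
    by (simp add: space_point_measure_space vimage_def Int_def conj_commute)
qed simp

end

theory Submission
  imports Defs
begin

text \<open>
  The law of \<open>\<Pi>\<close> has the empty configuration as an atom of mass \<open>exp (- \<lambda> \<L>(S))\<close>, so the law of
  \<open>f(\<Pi>)\<close> has an atom of at least that mass at the image \<open>\<nu>\<close> of the empty configuration. But a Poisson
  process of intensity \<open>\<mu> > \<lambda>\<close> has mass only \<open>exp (- \<mu> \<L>(S))\<close> at the empty configuration, and no other
  atom: a nonempty \<open>\<nu>\<close> charges sets of arbitrarily small volume, and a Poisson process charges such
  a set with arbitrarily small probability.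
\<close>

text \<open>Every measurable set lies inside \<open>S\<close> and inherits its mass 0. This makes
  \<open>f (N \<omega>)\<close> constant on the event that \<open>N\<close> has no points, so the
  atom can be handled through that event instead of through singletons of configurations.\<close>

lemma simple_point_measures_null_unique:
  assumes "\<nu> \<in> simple_point_measures S" "\<nu>' \<in> simple_point_measures S"
    and "emeasure \<nu> S = 0" "emeasure \<nu>' S = 0"
  shows "\<nu> = \<nu>'"
proof (rule measure_eqI)
  have sets: "sets \<nu> = sets (restrict_space borel S)" "sets \<nu>' = sets (restrict_space borel S)"
    using assms(1,2) by (auto simp: simple_point_measures_def)
  then show "sets \<nu> = sets \<nu>'"
    by simp
  have S: "S \<in> sets \<nu>" "S \<in> sets \<nu>'"
    using sets sets.top[of "restrict_space borel S"] by (auto simp: space_restrict_space)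
  fix A assume "A \<in> sets \<nu>"
  then have "A \<subseteq> S"
    using sets sets.sets_into_space by (fastforce simp: space_restrict_space)
  then show "emeasure \<nu> A = emeasure \<nu>' A"
    using emeasure_eq_0[OF S(1) assms(3)] emeasure_eq_0[OF S(2) assms(4)] by simp
qed

text \<open>Open sets of volume below \<epsilon> cover the space, and by Lindelof countably many of
  them suffice. If each piece cut out of \<open>S\<close> were null for \<nu>, countable
  subadditivity would make \<open>S\<close> null as well.\<close>

lemma exists_small_charged_set:
  fixes \<nu> :: "'a::euclidean_space measure"
  assumes sets: "sets \<nu> = sets (restrict_space borel S)"
    and "emeasure \<nu> S \<noteq> 0" and "\<epsilon> > 0"
  shows "\<exists>A\<in>sets \<nu>. emeasure \<nu> A \<noteq> 0 \<and> measure lborel A < \<epsilon>"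
proof (rule ccontr)
  assume no_small: "\<not> ?thesis"
  define \<U> where "\<U> = {U::'a set. open U \<and> emeasure lborel U < ennreal \<epsilon>}"
  have "\<exists>U\<in>\<U>. x \<in> U" for x
  proof -
    \<comment> \<open>Outer regularity bounds only the excess \<open>U - {x}\<close>; since a point
      is Lebesgue-null, \<open>U\<close> itself is just as small.\<close>
    obtain U where U: "open U" "{x} \<subseteq> U" "emeasure lborel (U - {x}) < ennreal \<epsilon>"
      using outer_regular_lborel[of "{x}" \<epsilon>] \<open>\<epsilon> > 0\<close> by auto
    have "emeasure lborel U = emeasure lborel (U - {x})"
      using U(1) by (intro emeasure_Diff_null_set[symmetric]) auto
    then show ?thesis
      using U by (auto simp: \<U>_def)
  qed
  then have "\<Union>\<U> = UNIV"
    by blast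
  moreover obtain \<V> where \<V>: "\<V> \<subseteq> \<U>" "countable \<V>" "\<Union>\<V> = \<Union>\<U>"
    using Lindelof[of \<U>] by (auto simp: \<U>_def)
  ultimately have S_eq: "S = (\<Union>U\<in>\<V>. S \<inter> U)"
    by auto
  have "S \<inter> U \<in> null_sets \<nu>" if "U \<in> \<V>" for U
  proof -
    have U: "open U" "emeasure lborel U < ennreal \<epsilon>"
      using that \<V>(1) by (auto simp: \<U>_def)
    have "emeasure lborel (S \<inter> U) \<le> emeasure lborel U"
      using U(1) by (intro emeasure_mono) auto
    then have "emeasure lborel (S \<inter> U) < ennreal \<epsilon>"
      using U(2) by (rule le_less_trans)
    then have "measure lborel (S \<inter> U) < \<epsilon>"
      using \<open>\<epsilon> > 0\<close> unfolding measure_def by (cases "emeasure lborel (S \<inter> U)") (auto simp: ennreal_less_iff)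
    moreover have "S \<inter> U \<in> sets \<nu>"
      using U(1) by (auto simp: sets sets_restrict_space)
    ultimately show ?thesis
      using no_small by (auto simp: null_sets_def)
  qed
  then have "(\<Union>U\<in>\<V>. S \<inter> U) \<in> null_sets \<nu>"
    using \<V>(2) by (intro null_sets_UN') auto
  with S_eq \<open>emeasure \<nu> S \<noteq> 0\<close> show False
    by (simp add: null_sets_def)
qed

theorem proposition10:
  fixes S :: "(real ^ 'd::finite) set" and r :: real
    and M :: "'w measure" and N :: "'w \<Rightarrow> (real ^ 'd) measure"
  assumes "r > 0"
    and "S \<in> sets borel" and "0 < emeasure lborel S" and "emeasure lborel S < \<infinity>"
    and "prob_space M" and "prob_space.poisson_process M S r N"
  shows "\<not> (\<exists>f. f \<in> measurable (point_measure_space S) (point_measure_space S) \<and>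
            (\<exists>\<mu>>r. prob_space.poisson_process M S \<mu> (\<lambda>\<omega>. f (N \<omega>))))"
proof
  interpret prob_space M by fact
  assume "\<exists>f. f \<in> measurable (point_measure_space S) (point_measure_space S) \<and>
            (\<exists>\<mu>>r. prob_space.poisson_process M S \<mu> (\<lambda>\<omega>. f (N \<omega>)))"
  then obtain f \<mu> where f: "f \<in> measurable (point_measure_space S) (point_measure_space S)"
    and \<mu>: "\<mu> > r" and pp_f: "poisson_process S \<mu> (\<lambda>\<omega>. f (N \<omega>))"
    by blast
  note pp = \<open>poisson_process S r N\<close>
  define v where "v = measure lborel S"
  define E where "E = {\<omega> \<in> space M. emeasure (N \<omega>) S = 0}"
  define F where "F A = {\<omega> \<in> space M. emeasure (f (N \<omega>)) A = 0}" for A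
  \<comment> \<open>Finite volume matters here too: \<open>measure\<close> assigns 0 to sets of
    infinite volume.\<close>
  have v: "v > 0"
    using assms(3,4) by (simp add: v_def measure_def enn2real_positive_iff)
  have \<mu>_pos: "\<mu> > 0"
    using \<open>r > 0\<close> \<mu> by simp
  have S: "S \<in> sets (restrict_space borel S)"
    using sets.top[of "restrict_space borel S"] by (simp add: space_restrict_space)
  have N: "N \<in> measurable M (point_measure_space S)"
    using pp by (simp add: poisson_process_def)
  have fN: "(\<lambda>\<omega>. f (N \<omega>)) \<in> measurable M (point_measure_space S)"
    using measurable_compose[OF N f] .
  have E_sets: "E \<in> events"
    using measurable_compose[OF N measurable_emeasure_point_measure_space[OF S]]
    unfolding E_def by measurable
  have F_sets: "F A \<in> events" if "A \<in> sets (restrict_space borel S)" for A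
    using measurable_compose[OF fN measurable_emeasure_point_measure_space[OF that]]
    unfolding F_def by measurable
  have prob_E: "prob E = exp (- (r * v))"
    using pp S unfolding poisson_process_def E_def v_def
    by (auto dest!: bspec[where x = S] spec[where x = 0])
  \<comment> \<open>The weight at \<open>k = 0\<close>; the convention \<open>0 ^ 0 = 1\<close>
    covers Lebesgue-null \<open>A\<close>.\<close>
  have prob_F: "prob (F A) = exp (- (\<mu> * measure lborel A))"
    if "A \<in> sets (restrict_space borel S)" for A
    using pp_f that unfolding poisson_process_def F_def
    by (auto dest!: bspec[where x = A] spec[where x = 0])
  have N_spm: "N \<omega> \<in> simple_point_measures S" if "\<omega> \<in> space M" for \<omega>
    using measurable_space[OF N that] by (simp add: space_point_measure_space)
  \<comment> \<open>Positive probability yields a sample point \<open>\<omega>0\<close>, whose image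
    under \<open>f\<close> is then the value of \<open>f (N \<omega>)\<close> on all of
    \<open>E\<close>.\<close>
  have "E \<noteq> {}"
    using prob_E by (metis exp_not_eq_zero measure_empty)
  then obtain \<omega>0 where \<omega>0: "\<omega>0 \<in> E"
    by blast
  define \<nu> where "\<nu> = f (N \<omega>0)"
  have f_E: "f (N \<omega>) = \<nu>" if "\<omega> \<in> E" for \<omega>
    using simple_point_measures_null_unique[of "N \<omega>" S "N \<omega>0"] N_spm that \<omega>0
    by (simp add: E_def \<nu>_def)
  have \<nu>_sets: "sets \<nu> = sets (restrict_space borel S)"
    using measurable_space[OF fN, of \<omega>0] \<omega>0
    by (simp add: E_def \<nu>_def space_point_measure_space simple_point_measures_def)
  show False
  proof (cases "emeasure \<nu> S = 0")
    \<comment> \<open>An empty \<nu> would make the void probability at rate \<mu> at least the one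
      at rate \<open>r\<close>, but void probabilities strictly decrease in the rate.\<close>
    case True
    then have "E \<subseteq> F S"
      using f_E by (auto simp: E_def F_def)
    then have "exp (- (r * v)) \<le> exp (- (\<mu> * v))"
      using finite_measure_mono[OF _ F_sets[OF S], of E] by (simp only: prob_E prob_F[OF S] v_def)
    then show False
      using \<mu> v by simp
  next
    case False
    \<comment> \<open>The threshold is chosen so that \<open>f (N \<omega>)\<close> charges
      \<open>A\<close> with probability at most \<open>\<mu> * measure lborel A\<close>, which is
      less than \<open>prob E\<close>; yet it charges \<open>A\<close> on all of
      \<open>E\<close>.\<close>
    obtain A where A: "A \<in> sets \<nu>" "emeasure \<nu> A \<noteq> 0" "measure lborel A < exp (- (r * v)) / \<mu>"
      using exists_small_charged_set[OF \<nu>_sets False, of "exp (- (r * v)) / \<mu>"] \<mu>_pos by auto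
    have A': "A \<in> sets (restrict_space borel S)"
      using A(1) \<nu>_sets by simp
    have "E \<inter> F A = {}"
      using f_E A(2) by (auto simp: F_def)
    then have "prob E + prob (F A) \<le> 1"
      using finite_measure_Union[OF E_sets F_sets[OF A']] prob_le_1[of "E \<union> F A"] by simp
    then have "exp (- (r * v)) + exp (- (\<mu> * measure lborel A)) \<le> 1"
      by (simp add: prob_E prob_F[OF A'])
    moreover have "1 - \<mu> * measure lborel A \<le> exp (- (\<mu> * measure lborel A))"
      using exp_ge_add_one_self[of "- (\<mu> * measure lborel A)"] by simp
    moreover have "\<mu> * measure lborel A < exp (- (r * v))"
      using A(3) \<mu>_pos by (simp add: field_simps)
    ultimately show False
      by linarith
  qed
qed

end
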